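(* Let $\mathfrak{A}^X$ be the set of all convex functions $A:[0,1]\to[1/2,1]$ satisfying $\max\{x,1-x\}\le A(x)\le 1$ and $A(x)=A(1-x)$ for all $x\in[0,1]$ (in particular $A(0)=A(1)=1$). For $0\le a\le 1/2$ let $$A_{a,1-a}(x):=\max\{a\,x,(1-a)(1-x)\}+\max\{(1-a)\,x,a\,(1-x)\},\qquad x\in[0,1].$$ Then $\mathfrak{A}^X$ is a simplex with extremal boundary (set of extreme points) $\partial_e\mathfrak{A}^X=\{A_{a,1-a}\,:\,0\le a\le 1/2\}$.
   Context: The set $\mathfrak{A}^X$ is the set of Pickands dependence functions of exchangeable bivariate extreme-value copulas; it is a convex set of functions on $[0,1]$, equipped with the topology of pointwise convergence. The extremal boundary $\partial_e K$ of a convex set $K$ is its set of extreme points. "Simplex" is meant in the sense of Choquet: a convex set $K$ of real-valued functions on a common domain is called a simplex if every $A\in K$ can be represented as a mixture $A(x)=\int_{\partial_e K}e(x)\,\nu(\mathrm{d}e)$ (for all $x$) with a unique Borel probability measure $\nu$ on $\partial_e K$. Here, with $\partial_e\mathfrak{A}^X$ parametrized by $a\in[0,1/2]$, this means that for every $A\in\mathfrak{A}^X$ there is a unique Borel probability measure $\nu$ on $[0,1/2]$ with $A(x)=\int_{[0,1/2]}A_{q,1-q}(x)\,\nu(\mathrm{d}q)$ for all $x\in[0,1]$. *)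

theory Defs
  imports "HOL-Probability.Probability"
begin

text \<open>A real-valued function on a domain \<open>D\<close> is an element of \<^term>\<open>extensional D\<close>, so that
  equality of such functions is equality on \<open>D\<close>.\<close>

definition mix :: "'a set \<Rightarrow> real \<Rightarrow> ('a \<Rightarrow> real) \<Rightarrow> ('a \<Rightarrow> real) \<Rightarrow> 'a \<Rightarrow> real" where
  "mix D t f g = (\<lambda>x\<in>D. (1 - t) * f x + t * g x)"

definition convex_function_set :: "'a set \<Rightarrow> ('a \<Rightarrow> real) set \<Rightarrow> bool" where
  "convex_function_set D K \<longleftrightarrow>
     K \<subseteq> extensional D \<and> (\<forall>f\<in>K. \<forall>g\<in>K. \<forall>t\<in>{0..1}. mix D t f g \<in> K)"

text \<open>The condition is that of \<^const>\<open>extreme_point_of\<close>, which is not available here because the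
  function type is not an instance of \<^class>\<open>real_vector\<close>.\<close>

definition extreme_functions :: "'a set \<Rightarrow> ('a \<Rightarrow> real) set \<Rightarrow> ('a \<Rightarrow> real) set" where
  "extreme_functions D K =
     {e \<in> K. \<forall>f\<in>K. \<forall>g\<in>K. \<forall>t\<in>{0<..<1}. e = mix D t f g \<longrightarrow> f = g}"

text \<open>On the function type, \<^const>\<open>borel\<close> belongs to the product topology, that is, to pointwise
  convergence on the whole type. On subsets of \<^term>\<open>extensional D\<close> all coordinates outside \<open>D\<close>
  are constant, so the trace \<open>\<sigma>\<close>-algebra below is the Borel \<open>\<sigma>\<close>-algebra of pointwise
  convergence on \<open>D\<close>.\<close>

definition choquet_simplex :: "'a set \<Rightarrow> ('a \<Rightarrow> real) set \<Rightarrow> bool" where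
  "choquet_simplex D K \<longleftrightarrow>
     convex_function_set D K \<and>
     (\<forall>A\<in>K. \<exists>!\<nu>. prob_space \<nu> \<and>
        sets \<nu> = sets (restrict_space borel (extreme_functions D K)) \<and>
        (\<forall>x\<in>D. has_bochner_integral \<nu> (\<lambda>e. e x) (A x)))"

definition exchangeable_pickands :: "(real \<Rightarrow> real) set" where
  "exchangeable_pickands =
     {A \<in> {0..1} \<rightarrow>\<^sub>E {1/2..1}. convex_on {0..1} A \<and>
        (\<forall>x\<in>{0..1}. max x (1 - x) \<le> A x \<and> A x \<le> 1 \<and> A x = A (1 - x))}"

definition pickands_extreme :: "real \<Rightarrow> real \<Rightarrow> real" where
  "pickands_extreme a =
     (\<lambda>x\<in>{0..1}. max (a * x) ((1 - a) * (1 - x)) + max ((1 - a) * x) (a * (1 - x)))"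

end

theory Submission
  imports Defs
begin

text \<open>On \<open>[0, 1/2]\<close> the function \<open>A\<^bsub>a,1-a\<^esub>\<close> is \<open>1 - min a x\<close>, so a mixing measure \<open>\<nu>\<close> represents \<open>A\<close>
  iff the concave function \<open>g = 1 - A\<close> satisfies \<open>g x = \<integral> min q x d\<nu>\<close>. Such a truncated mean has increments
  \<open>(y - x) (1 - F y) \<le> g y - g x \<le> (y - x) (1 - F x)\<close> with \<open>F\<close> the distribution function of \<open>\<nu>\<close>.
  Letting \<open>y\<close> decrease to \<open>x\<close> recovers \<open>F\<close> from \<open>g\<close>, which is uniqueness. Conversely,
  \<open>F = 1 - g'\<close> (right derivative) is a distribution function and satisfies the same bounds by
  concavity; the bounds determine \<open>g\<close> up to a constant, which is existence.\<close>

section \<open>Integrals of truncations and distribution functions\<close>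

lemma (in real_distribution) truncated_mean_increment_bounds:
  assumes x: "has_bochner_integral M (\<lambda>q. min q x) a"
    and y: "has_bochner_integral M (\<lambda>q. min q y) b"
    and "x \<le> y"
  shows "(y - x) * (1 - cdf M y) \<le> b - a" and "b - a \<le> (y - x) * (1 - cdf M x)"
proof -
  have tail: "1 - cdf M t = measure M {t<..}" for t
  proof -
    have "- {..t} = {t<..}" by auto
    then show ?thesis
      using prob_compl[of "{..t}"] by (simp add: cdf_def Compl_eq_Diff_UNIV)
  qed
  have diff: "has_bochner_integral M (\<lambda>q. min q y - min q x) (b - a)"
    using y x by (rule has_bochner_integral_diff)
  have ind: "has_bochner_integral M (\<lambda>q. (y - x) * indicator {t<..} q) ((y - x) * (1 - cdf M t))" for t
    unfolding tail by (intro has_bochner_integral_mult_right has_bochner_integral_real_indicator)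
      (auto simp: less_top[symmetric])
  show "(y - x) * (1 - cdf M y) \<le> b - a"
    using integral_mono[of M "\<lambda>q. (y - x) * indicator {y<..} q" "\<lambda>q. min q y - min q x"]
      ind[of y] diff \<open>x \<le> y\<close>
    by (force simp: has_bochner_integral_iff indicator_def)
  show "b - a \<le> (y - x) * (1 - cdf M x)"
    using integral_mono[of M "\<lambda>q. min q y - min q x" "\<lambda>q. (y - x) * indicator {x<..} q"]
      ind[of x] diff \<open>x \<le> y\<close>
    by (force simp: has_bochner_integral_iff indicator_def)
qed

lemma cdf_le_of_truncated_means_eq:
  assumes M: "real_distribution M" and N: "real_distribution N"
    and gM: "\<And>x. x \<in> {a..b} \<Longrightarrow> has_bochner_integral M (\<lambda>q. min q x) (g x)"
    and gN: "\<And>x. x \<in> {a..b} \<Longrightarrow> has_bochner_integral N (\<lambda>q. min q x) (g x)"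
    and x: "a \<le> x" "x < b"
  shows "cdf M x \<le> cdf N x"
proof -
  interpret M: real_distribution M by fact
  interpret N: real_distribution N by fact
  have le: "cdf M x \<le> cdf N y" if "x < y" "y < b" for y
  proof -
    have "(y - x) * (1 - cdf N y) \<le> g y - g x"
      using that x by (intro N.truncated_mean_increment_bounds gN) auto
    also have "\<dots> \<le> (y - x) * (1 - cdf M x)"
      using that x by (intro M.truncated_mean_increment_bounds gM) auto
    finally show ?thesis using that by simp
  qed
  have "(cdf N \<longlongrightarrow> cdf N x) (at_right x)"
    using N.cdf_is_right_cont[of x] by (simp add: continuous_within)
  moreover have "\<forall>\<^sub>F y in at_right x. cdf M x \<le> cdf N y"
    using eventually_at_right_less[of x] eventually_at_right_real[OF x(2)]
    by eventually_elim (use le in auto)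
  ultimately show ?thesis
    by (intro tendsto_lowerbound) auto
qed

lemma increments_bounded_imp_eq:
  fixes D F :: "real \<Rightarrow> real"
  assumes "a \<le> b"
    and inc: "\<And>s t. a \<le> s \<Longrightarrow> s \<le> t \<Longrightarrow> t \<le> b \<Longrightarrow> \<bar>D t - D s\<bar> \<le> (t - s) * (F t - F s)"
  shows "D b = D a"
proof -
  define K where "K = (b - a) * (F b - F a)"
  have bound: "real n * \<bar>D b - D a\<bar> \<le> K" if "n > 0" for n :: nat
  proof -
    define h where "h = (b - a) / n"
    define t where "t i = a + real i * h" for i
    have h: "h \<ge> 0" and t0: "t 0 = a" and tn: "t n = b"
      using \<open>a \<le> b\<close> that by (auto simp: h_def t_def)
    have step: "\<bar>D (t (Suc i)) - D (t i)\<bar> \<le> h * (F (t (Suc i)) - F (t i))" if "i < n" for i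
    proof -
      have "t (Suc i) \<le> t n" unfolding t_def
        using h that by (intro add_left_mono mult_right_mono) auto
      moreover have "t (Suc i) - t i = h" by (simp add: t_def algebra_simps)
      moreover have "a \<le> t i" using h by (simp add: t_def)
      ultimately show ?thesis using inc[of "t i" "t (Suc i)"] h tn by simp
    qed
    have "\<bar>D b - D a\<bar> = \<bar>\<Sum>i<n. D (t (Suc i)) - D (t i)\<bar>"
      using sum_lessThan_telescope[of "\<lambda>i. D (t i)" n] by (simp add: t0 tn)
    also have "\<dots> \<le> (\<Sum>i<n. \<bar>D (t (Suc i)) - D (t i)\<bar>)" by (rule sum_abs)
    also have "\<dots> \<le> (\<Sum>i<n. h * (F (t (Suc i)) - F (t i)))"
      using step by (intro sum_mono) auto
    also have "\<dots> = h * (F b - F a)"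
      using sum_lessThan_telescope[of "\<lambda>i. F (t i)" n]
      by (simp add: t0 tn flip: sum_distrib_left)
    finally show ?thesis using that by (simp add: h_def K_def field_simps)
  qed
  show ?thesis
  proof (rule ccontr)
    assume "D b \<noteq> D a"
    then obtain n where "K < real n * \<bar>D b - D a\<bar>"
      using reals_Archimedean3[of "\<bar>D b - D a\<bar>"] by auto
    with bound[of "Suc n"] show False
      by (auto simp: algebra_simps)
  qed
qed

section \<open>Exchangeable Pickands functions\<close>

lemma pickands_extreme_eq:
  assumes "0 \<le> a" "a \<le> 1/2" "x \<in> {0..1}"
  shows "pickands_extreme a x = 1 - min a (min x (1 - x))"
proof -
  have "a * x \<le> (1 - a) * (1 - x) \<longleftrightarrow> a + x \<le> 1" "(1 - a) * x \<le> a * (1 - x) \<longleftrightarrow> x \<le> a"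
    by (auto simp: algebra_simps)
  then show ?thesis
    using assms by (auto simp: pickands_extreme_def max_def min_def algebra_simps)
qed

lemma pickands_extreme_half: "0 \<le> a \<Longrightarrow> a \<le> 1/2 \<Longrightarrow> pickands_extreme a (1/2) = 1 - a"
  by (simp add: pickands_extreme_eq)

lemma exchangeable_pickands_restrictI:
  assumes "convex_on {0..1} A"
    and "\<And>x. x \<in> {0..1} \<Longrightarrow> max x (1 - x) \<le> A x \<and> A x \<le> 1 \<and> A x = A (1 - x)"
  shows "(\<lambda>x\<in>{0..1}. A x) \<in> exchangeable_pickands"
proof -
  have "convex_on {0..1} (\<lambda>x\<in>{0..1}. A x)"
  proof (rule convex_onI)
    fix t x y :: real assume t: "t > 0" "t < 1" and xy: "x \<in> {0..1}" "y \<in> {0..1}"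
    then have "(1 - t) *\<^sub>R x + t *\<^sub>R y \<in> {0..1}" by (intro convexD_alt) auto
    then show "restrict A {0..1} ((1 - t) *\<^sub>R x + t *\<^sub>R y)
        \<le> (1 - t) * restrict A {0..1} x + t * restrict A {0..1} y"
      using convex_onD[OF assms(1), of t x y] t xy by simp
  qed auto
  moreover have "A x \<ge> 1/2" if "x \<in> {0..1}" for x
    using assms(2)[OF that] by (auto simp: max_def split: if_splits)
  moreover have "A x \<le> 1" if "x \<in> {0..1}" for x
    using assms(2)[OF that] by blast
  ultimately have "(\<lambda>x\<in>{0..1}. A x) \<in> {0..1} \<rightarrow>\<^sub>E {1/2..1}"
    and "convex_on {0..1} (\<lambda>x\<in>{0..1}. A x)"
    by auto
  moreover have "\<forall>x\<in>{0..1}. max x (1 - x) \<le> restrict A {0..1} x \<and> restrict A {0..1} x \<le> 1 \<and>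
      restrict A {0..1} x = restrict A {0..1} (1 - x)"
  proof
    fix x :: real assume x: "x \<in> {0..1}"
    then have r: "restrict A {0..1} x = A x" "restrict A {0..1} (1 - x) = A (1 - x)" by simp_all
    show "max x (1 - x) \<le> restrict A {0..1} x \<and> restrict A {0..1} x \<le> 1 \<and>
        restrict A {0..1} x = restrict A {0..1} (1 - x)"
      unfolding r using assms(2)[OF x] .
  qed
  ultimately show ?thesis
    unfolding exchangeable_pickands_def by blast
qed

lemma exchangeable_pickandsD:
  assumes "A \<in> exchangeable_pickands"
  shows "A \<in> extensional {0..1}" "convex_on {0..1} A"
    and "x \<in> {0..1} \<Longrightarrow> max x (1 - x) \<le> A x" "x \<in> {0..1} \<Longrightarrow> A x \<le> 1"
    and "x \<in> {0..1} \<Longrightarrow> A (1 - x) = A x"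
proof -
  have *: "A \<in> {0..1} \<rightarrow>\<^sub>E {1/2..1}" "convex_on {0..1} A"
      "\<forall>x\<in>{0..1}. max x (1 - x) \<le> A x \<and> A x \<le> 1 \<and> A x = A (1 - x)"
    using assms unfolding exchangeable_pickands_def by blast+
  show "A \<in> extensional {0..1}" using *(1) unfolding PiE_def by blast
  show "convex_on {0..1} A" by (rule *)
  show "max x (1 - x) \<le> A x" "A x \<le> 1" "A (1 - x) = A x" if "x \<in> {0..1}"
    using *(3)[rule_format, OF that] by (blast intro: sym[of "A x"])+
qed

lemma pickands_extreme_in:
  assumes "0 \<le> a" "a \<le> 1/2" shows "pickands_extreme a \<in> exchangeable_pickands"
proof -
  let ?A = "\<lambda>x. max (a * x) ((1 - a) * (1 - x)) + max ((1 - a) * x) (a * (1 - x))"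
  have lin: "convex_on {0..1} (\<lambda>x. c * x + d)" for c d :: real
    by (rule convex_onI) (auto simp: algebra_simps)
  have lin': "convex_on {0..1} (\<lambda>x. c * x)" "convex_on {0..1} (\<lambda>x. c * (1 - x))" for c :: real
    using lin[of c 0] lin[of "-c" c] by (auto simp: algebra_simps)
  have mx: "convex_on {0..1} (\<lambda>x. max (f x) (g x))"
    if "convex_on {0..1} f" "convex_on {0..1} g" for f g :: "real \<Rightarrow> real"
  proof (rule convex_onI)
    fix t x y :: real assume *: "t > 0" "t < 1" "x \<in> {0..1}" "y \<in> {0..1}"
    have "(1 - t) * f x \<le> (1 - t) * max (f x) (g x)" "(1 - t) * g x \<le> (1 - t) * max (f x) (g x)"
      "t * f y \<le> t * max (f y) (g y)" "t * g y \<le> t * max (f y) (g y)"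
      using * by (auto intro!: mult_left_mono)
    moreover have "f ((1 - t) *\<^sub>R x + t *\<^sub>R y) \<le> (1 - t) * f x + t * f y"
      "g ((1 - t) *\<^sub>R x + t *\<^sub>R y) \<le> (1 - t) * g x + t * g y"
      using * convex_onD[OF that(1), of t x y] convex_onD[OF that(2), of t x y] by auto
    ultimately show "max (f ((1 - t) *\<^sub>R x + t *\<^sub>R y)) (g ((1 - t) *\<^sub>R x + t *\<^sub>R y))
        \<le> (1 - t) * max (f x) (g x) + t * max (f y) (g y)" by (intro max.boundedI; linarith)
  qed auto
  have eq: "?A x = 1 - min a (min x (1 - x))" if "x \<in> {0..1}" for x
    using pickands_extreme_eq[OF assms that] that by (simp add: pickands_extreme_def)
  show ?thesis
    unfolding pickands_extreme_def
  proof (rule exchangeable_pickands_restrictI)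
    show "convex_on {0..1} ?A" by (intro convex_on_add mx lin')
    show "max x (1 - x) \<le> ?A x \<and> ?A x \<le> 1 \<and> ?A x = ?A (1 - x)" if "x \<in> {0..1}" for x
    proof -
      have "1 - x \<in> {0..1}" using that by simp
      then show ?thesis
        unfolding eq[OF that] eq[OF \<open>1 - x \<in> {0..1}\<close>] using that assms by auto
    qed
  qed
qed

lemma convex_function_set_exchangeable_pickands:
  "convex_function_set {0..1} exchangeable_pickands"
  unfolding convex_function_set_def
proof (intro conjI ballI)
  show "exchangeable_pickands \<subseteq> extensional {0..1}"
    using exchangeable_pickandsD(1) by blast
  fix f g and t :: real
  assume f: "f \<in> exchangeable_pickands" and g: "g \<in> exchangeable_pickands" and t: "t \<in> {0..1}"
  show "mix {0..1} t f g \<in> exchangeable_pickands"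
    unfolding mix_def
  proof (rule exchangeable_pickands_restrictI)
    show "convex_on {0..1} (\<lambda>x. (1 - t) * f x + t * g x)"
      using f g t by (intro convex_on_add convex_on_cmul exchangeable_pickandsD) auto
    fix x :: real assume x: "x \<in> {0..1}"
    note D = exchangeable_pickandsD[OF f] exchangeable_pickandsD[OF g]
    have low: "c \<le> (1 - t) * u + t * v" if "c \<le> u" "c \<le> v" for c u v
    proof -
      have "(1 - t) * c \<le> (1 - t) * u" "t * c \<le> t * v"
        using that t by (auto intro: mult_left_mono)
      then show ?thesis by (simp add: algebra_simps)
    qed
    have high: "(1 - t) * u + t * v \<le> 1" if "u \<le> 1" "v \<le> 1" for u v
      using t that by (intro convex_bound_le) auto
    show "max x (1 - x) \<le> (1 - t) * f x + t * g x \<and> (1 - t) * f x + t * g x \<le> 1 \<and>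
        (1 - t) * f x + t * g x = (1 - t) * f (1 - x) + t * g (1 - x)"
      using D(3-5,8-10)[OF x] by (simp only: low high simp_thms)
  qed
qed

locale exchangeable_pickands_function =
  fixes A
  assumes mem: "A \<in> exchangeable_pickands"
begin

lemma convex: "convex_on {0..1} A"
  and bounds: "x \<in> {0..1} \<Longrightarrow> 1 - x \<le> A x" "x \<in> {0..1} \<Longrightarrow> A x \<le> 1"
  and sym: "x \<in> {0..1} \<Longrightarrow> A (1 - x) = A x"
  and zero: "A 0 = 1"
  using exchangeable_pickandsD[OF mem] exchangeable_pickandsD(3,4)[OF mem, of 0]
  by (simp_all add: antisym)

lemma slope_mono:
  assumes "0 \<le> x" "x < y" "y < z" "z \<le> 1"
  shows "(A y - A x) / (y - x) \<le> (A z - A y) / (z - y)"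
proof -
  have "(A x - A y) / (x - y) \<le> (A y - A z) / (y - z)"
    using convex_on_slope_le[OF convex, of x z y] assms by auto
  then show ?thesis
    by (metis minus_diff_eq minus_divide_divide)
qed

lemma antimono:
  assumes "0 \<le> x" "x \<le> y" "y \<le> 1/2" shows "A y \<le> A x"
proof (cases "x = y")
  case False
  then have *: "x < y" "y < 1 - x" using assms by auto
  have "(A x - A y) / (x - y) \<le> (A x - A (1 - x)) / (x - (1 - x))"
    using * assms by (intro convex_on_slope_le[OF convex]) auto
  then have "(A x - A y) / (x - y) \<le> 0" using sym[of x] * assms by simp
  then show ?thesis using * by (simp add: divide_le_0_iff)
qed simp

lemma decrease_le:
  assumes "0 \<le> x" "x \<le> y" "y \<le> 1/2" shows "A x - A y \<le> y - x"
proof (cases "x = 0 \<or> x = y")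
  case True
  then show ?thesis using bounds[of y] zero assms by auto
next
  case False
  then have *: "0 < x" "x < y" using assms by auto
  have "-1 \<le> (A x - A 0) / (x - 0)"
    using * bounds[of x] zero assms by (simp add: field_simps)
  also have "\<dots> \<le> (A y - A x) / (y - x)"
    using * assms by (intro slope_mono) auto
  finally show ?thesis using * by (simp add: field_simps)
qed

text \<open>On \<open>[0, 1/2)\<close> this is \<open>1 + A'\<close> with the right derivative \<open>A'\<close> as an infimum of slopes.\<close>

definition F :: "real \<Rightarrow> real" where
  "F t = (if t < 0 then 0 else if 1/2 \<le> t then 1
          else 1 + (INF u\<in>{t<..1/2}. (A u - A t) / (u - t)))"

lemma F_le_slope:
  assumes "0 \<le> t" "t < u" "u \<le> 1/2" shows "F t \<le> 1 + (A u - A t) / (u - t)"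
proof -
  have "bdd_below ((\<lambda>u. (A u - A t) / (u - t)) ` {t<..1/2})"
    by (rule bdd_belowI2[where m = "-1"]) (use decrease_le assms in \<open>auto simp: field_simps\<close>)
  then have "(INF u\<in>{t<..1/2}. (A u - A t) / (u - t)) \<le> (A u - A t) / (u - t)"
    by (rule cINF_lower) (use assms in auto)
  then show ?thesis using assms by (simp add: F_def)
qed

lemma F_geI:
  assumes "0 \<le> t" "t < 1/2" "\<And>u. t < u \<Longrightarrow> u \<le> 1/2 \<Longrightarrow> c \<le> 1 + (A u - A t) / (u - t)"
  shows "c \<le> F t"
proof -
  have "c - 1 \<le> (INF u\<in>{t<..1/2}. (A u - A t) / (u - t))"
    by (rule cINF_greatest) (use assms in \<open>auto simp: algebra_simps\<close>)
  then show ?thesis using assms by (simp add: F_def)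
qed

lemma slope_le_F:
  assumes "0 \<le> t" "t < u" "u \<le> 1/2" shows "1 + (A u - A t) / (u - t) \<le> F u"
proof (cases "u = 1/2")
  case True
  moreover have "(A u - A t) / (u - t) \<le> 0"
    using antimono[of t u] assms by (intro divide_nonpos_pos) auto
  ultimately show ?thesis by (simp add: F_def)
next
  case False
  then show ?thesis using assms slope_mono by (intro F_geI) auto
qed

lemma F_nonneg: "0 \<le> F t"
proof (cases "0 \<le> t \<and> t < 1/2")
  case True
  then show ?thesis
    by (intro F_geI) (use decrease_le in \<open>auto simp: field_simps\<close>)
qed (auto simp: F_def)

lemma F_mono: "x \<le> y \<Longrightarrow> F x \<le> F y"
proof -
  have le: "F x \<le> F y" if "0 \<le> x" "x < y" "y \<le> 1/2" for x y
    using F_le_slope[OF that] slope_le_F[OF that] by simp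
  assume "x \<le> y"
  show ?thesis
  proof (cases "x < 0 \<or> x = y \<or> 1/2 \<le> x")
    case True
    then show ?thesis using F_nonneg[of y] \<open>x \<le> y\<close> by (auto simp: F_def)
  next
    case False
    then show ?thesis
    proof (cases "y \<le> 1/2")
      case True
      then show ?thesis using False \<open>x \<le> y\<close> by (intro le) auto
    next
      case *: False
      then have "F y = F (1/2)" by (simp add: F_def)
      then show ?thesis using le[of x "1/2"] False by auto
    qed
  qed
qed

lemma F_right_continuous: "continuous (at_right t) F"
proof -
  consider "t < 0" | "0 \<le> t" "t < 1/2" | "1/2 \<le> t" by linarith
  then show ?thesis
  proof cases
    case 1
    then have "\<forall>\<^sub>F x in at_right t. F x = F t"
      using eventually_at_right_real[of t 0] by (auto elim!: eventually_mono simp: F_def)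
    then show ?thesis unfolding continuous_within by (rule tendsto_eventually)
  next
    case 3
    then have "\<forall>\<^sub>F x in at_right t. F x = F t"
      using eventually_at_right_less[of t] by (auto elim!: eventually_mono simp: F_def)
    then show ?thesis unfolding continuous_within by (rule tendsto_eventually)
  next
    case 2
    have near: "\<forall>\<^sub>F x in at_right t. t < x \<and> x < u" if "t < u" for u
      using eventually_at_right_real[OF that] by simp
    have A: "(A \<longlongrightarrow> A t) (at_right t)"
    proof (rule tendsto_sandwich)
      show "\<forall>\<^sub>F x in at_right t. A t - (x - t) \<le> A x"
        using near[OF 2(2)] by eventually_elim (use decrease_le 2 in \<open>auto simp: algebra_simps\<close>)
      show "\<forall>\<^sub>F x in at_right t. A x \<le> A t"
        using near[OF 2(2)] by eventually_elim (use antimono 2 in auto)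
      show "((\<lambda>x. A t - (x - t)) \<longlongrightarrow> A t) (at_right t)"
        by (auto intro!: tendsto_eq_intros)
    qed simp
    show ?thesis
      unfolding continuous_within
    proof (rule order_tendstoI)
      fix a assume a: "a < F t"
      show "\<forall>\<^sub>F x in at_right t. a < F x"
        using eventually_at_right_less[of t]
        by eventually_elim (meson a F_mono less_imp_le less_le_trans)
    next
      fix a assume "F t < a"
      then obtain u where u: "t < u" "u \<le> 1/2" "1 + (A u - A t) / (u - t) < a"
        using F_geI[of t a] 2 by force
      have "((\<lambda>x. 1 + (A u - A x) / (u - x)) \<longlongrightarrow> 1 + (A u - A t) / (u - t)) (at_right t)"
        using u by (intro tendsto_intros A) auto
      from order_tendstoD(2)[OF this u(3)] near[OF u(1)]
      show "\<forall>\<^sub>F x in at_right t. F x < a"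
      proof eventually_elim
        case (elim x)
        then show ?case using F_le_slope[of x u] u 2 by auto
      qed
    qed
  qed
qed

lemma increment_bounds:
  assumes "0 \<le> x" "x \<le> y" "y \<le> 1/2"
  shows "(y - x) * (1 - F y) \<le> A x - A y" and "A x - A y \<le> (y - x) * (1 - F x)"
proof -
  have "(y - x) * (1 - F y) \<le> A x - A y \<and> A x - A y \<le> (y - x) * (1 - F x)"
  proof (cases "x = y")
    case False
    then have *: "x < y" using assms by simp
    show ?thesis
      using slope_le_F[OF assms(1) * assms(3)] F_le_slope[OF assms(1) * assms(3)] *
      by (simp add: field_simps)
  qed simp
  then show "(y - x) * (1 - F y) \<le> A x - A y" "A x - A y \<le> (y - x) * (1 - F x)" by auto
qed

lemma ex_truncated_mean_representation:
  "\<exists>M. real_distribution M \<and> measure M {0..1/2} = 1 \<and>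
     (\<forall>x\<in>{0..1/2}. has_bochner_integral M (\<lambda>q. min q x) (1 - A x))"
proof -
  define M where "M = interval_measure F"
  have "(F \<longlongrightarrow> 0) at_bot"
    by (intro tendsto_eventually eventually_at_bot_linorderI[of "-1"]) (auto simp: F_def)
  moreover have "(F \<longlongrightarrow> 1) at_top"
    by (intro tendsto_eventually eventually_at_top_linorderI[of 1]) (auto simp: F_def)
  ultimately have dist: "real_distribution M" and cdf: "cdf M = F"
    unfolding M_def
    by (auto intro!: real_distribution_interval_measure cdf_interval_measure
        simp: F_mono F_right_continuous)
  interpret M: real_distribution M by fact
  have "\<forall>\<^sub>F t in at_left (0::real). F t = 0"
    using eventually_at_left_real[of "-1" "0::real"] by (auto elim!: eventually_mono simp: F_def)
  then have "(F \<longlongrightarrow> 0) (at_left 0)" by (rule tendsto_eventually)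
  then have "measure M {..<0} = 0"
    using M.cdf_at_left[of 0] unfolding cdf by (intro tendsto_unique[of "at_left 0" F]) auto
  moreover have "measure M {..1/2} = 1"
    using cdf by (simp add: cdf_def fun_eq_iff F_def)
  moreover have "measure M {..1/2} = measure M {..<0} + measure M {0..1/2}"
    by (subst M.finite_measure_Union[symmetric]) (auto intro!: arg_cong[where f = "measure M"])
  ultimately have one: "measure M {0..1/2} = 1" by simp
  then have AE: "AE q in M. q \<in> {0..1/2}"
    by (subst M.AE_in_set_eq_1) auto
  define I where "I x = (\<integral>q. min q x \<partial>M)" for x
  have I: "has_bochner_integral M (\<lambda>q. min q x) (I x)" if "0 \<le> x" for x
    unfolding I_def
  proof (rule has_bochner_integral_integrable)
    show "integrable M (\<lambda>q. min q x)"
      by (rule M.integrable_const_bound[where B = x]) (use AE that in \<open>auto elim!: AE_mp\<close>)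
  qed
  have I0: "I 0 = 0"
    unfolding I_def by (rule integral_eq_zero_AE) (use AE in \<open>auto elim!: AE_mp\<close>)
  have "I x = 1 - A x" if x: "x \<in> {0..1/2}" for x
  proof -
    have "(1 - A x) - I x = (1 - A 0) - I 0"
    proof (rule increments_bounded_imp_eq[where D = "\<lambda>t. (1 - A t) - I t" and F = F])
      fix s t assume st: "0 \<le> s" "s \<le> t" "t \<le> x"
      have "(t - s) * (1 - F t) \<le> I t - I s" "I t - I s \<le> (t - s) * (1 - F s)"
        using M.truncated_mean_increment_bounds[OF I I, of s t] st cdf by auto
      with increment_bounds[of s t] st x
      show "\<bar>(1 - A t) - I t - ((1 - A s) - I s)\<bar> \<le> (t - s) * (F t - F s)"
        by (auto simp: abs_le_iff algebra_simps)
    qed (use x in auto)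
    then show ?thesis using I0 zero by simp
  qed
  then show ?thesis using dist one I by (metis atLeastAtMost_iff)
qed

end

section \<open>Mixtures of extreme functions\<close>

locale prob_on_half = prob_space \<nu> for \<nu> :: "real measure" +
  assumes sets_eq: "sets \<nu> = sets (restrict_space borel {0..1/2})"
begin

lemma space_eq: "space \<nu> = {0..1/2}"
  using sets_eq_imp_space_eq[OF sets_eq] by (simp add: space_restrict_space)

lemma measurable_pickands_extreme [measurable]:
  "x \<in> {0..1} \<Longrightarrow> (\<lambda>q. pickands_extreme q x) \<in> borel_measurable \<nu>"
  unfolding measurable_cong_sets[OF sets_eq refl] pickands_extreme_def
  by (intro borel_measurable_continuous_on_restrict) (auto intro!: continuous_intros)

lemma measurable_of_borel: "f \<in> borel_measurable borel \<Longrightarrow> f \<in> borel_measurable \<nu>"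
  unfolding measurable_cong_sets[OF sets_eq refl] by (rule measurable_restrict_space1)

lemma measurable_id_borel [simp]: "(\<lambda>q. q) \<in> borel_measurable \<nu>"
  by (rule measurable_of_borel) simp

lemma real_distribution_borel: "real_distribution (distr \<nu> borel (\<lambda>q. q))"
  by (rule real_distribution_distr) simp

lemma restrict_distr_borel: "restrict_space (distr \<nu> borel (\<lambda>q. q)) {0..1/2} = \<nu>"
proof (rule measure_eqI)
  fix X assume "X \<in> sets (restrict_space (distr \<nu> borel (\<lambda>q. q)) {0..1/2})"
  then obtain Y where X: "X = {0..1/2} \<inter> Y" "Y \<in> sets borel"
    by (auto simp: sets_restrict_space)
  then have "emeasure (restrict_space (distr \<nu> borel (\<lambda>q. q)) {0..1/2}) X
      = emeasure (distr \<nu> borel (\<lambda>q. q)) X"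
    by (intro emeasure_restrict_space) auto
  also have "\<dots> = emeasure \<nu> X"
    using X space_eq by (subst emeasure_distr) (auto intro!: arg_cong[where f = "emeasure \<nu>"])
  finally show "emeasure (restrict_space (distr \<nu> borel (\<lambda>q. q)) {0..1/2}) X = emeasure \<nu> X" .
qed (simp add: sets_eq sets_restrict_space)

lemma pickands_extreme_bounds:
  assumes "q \<in> space \<nu>" "x \<in> {0..1}"
  shows "max x (1 - x) \<le> pickands_extreme q x" "pickands_extreme q x \<le> 1"
    "pickands_extreme q (1 - x) = pickands_extreme q x" "0 \<le> pickands_extreme q x"
  using assms by (auto simp: space_eq pickands_extreme_eq)

lemma integrable_weighted:
  assumes "w \<in> borel_measurable \<nu>" "\<And>q. q \<in> space \<nu> \<Longrightarrow> \<bar>w q\<bar> \<le> C" "x \<in> {0..1}"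
  shows "integrable \<nu> (\<lambda>q. w q * pickands_extreme q x)"
proof (rule integrable_const_bound[where B = C])
  have "\<bar>w q * pickands_extreme q x\<bar> \<le> C * 1" if "q \<in> space \<nu>" for q
    unfolding abs_mult
    using assms that pickands_extreme_bounds[OF that \<open>x \<in> {0..1}\<close>]
    by (intro mult_mono) (auto intro: order_trans[OF abs_ge_zero])
  then show "AE q in \<nu>. norm (w q * pickands_extreme q x) \<le> C" by auto
qed (use assms in measurable)

lemma weighted_mixture_in:
  assumes [measurable]: "w \<in> borel_measurable \<nu>"
    and w: "\<And>q. q \<in> space \<nu> \<Longrightarrow> 0 \<le> w q" "\<And>q. q \<in> space \<nu> \<Longrightarrow> w q \<le> C"
    and one: "(\<integral>q. w q \<partial>\<nu>) = 1"
  shows "(\<lambda>x\<in>{0..1}. \<integral>q. w q * pickands_extreme q x \<partial>\<nu>) \<in> exchangeable_pickands"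
proof (rule exchangeable_pickands_restrictI)
  have int: "integrable \<nu> (\<lambda>q. w q * pickands_extreme q x)" if "x \<in> {0..1}" for x
    using w that by (intro integrable_weighted[where C = C]) (auto simp: abs_le_iff intro: order_trans)
  have intw: "integrable \<nu> w"
    using one not_integrable_integral_eq by fastforce
  show "convex_on {0..1} (\<lambda>x. \<integral>q. w q * pickands_extreme q x \<partial>\<nu>)"
  proof (rule convex_onI)
    fix t x y :: real assume t: "t > 0" "t < 1" and xy: "x \<in> {0..1}" "y \<in> {0..1}"
    let ?z = "(1 - t) *\<^sub>R x + t *\<^sub>R y"
    have z: "?z \<in> {0..1}"
      using t xy by (intro convexD_alt) auto
    have "(\<integral>q. w q * pickands_extreme q ?z \<partial>\<nu>)
        \<le> (\<integral>q. (1 - t) * (w q * pickands_extreme q x) + t * (w q * pickands_extreme q y) \<partial>\<nu>)"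
    proof (rule integral_mono)
      fix q assume q: "q \<in> space \<nu>"
      then have "convex_on {0..1} (pickands_extreme q)"
        using exchangeable_pickandsD(2)[OF pickands_extreme_in, of q] by (simp add: space_eq)
      then have "pickands_extreme q ?z \<le> (1 - t) * pickands_extreme q x + t * pickands_extreme q y"
        using t xy by (intro convex_onD) auto
      from mult_left_mono[OF this w(1)[OF q]]
      show "w q * pickands_extreme q ?z
          \<le> (1 - t) * (w q * pickands_extreme q x) + t * (w q * pickands_extreme q y)"
        by (simp add: algebra_simps)
    qed (use int z xy in auto)
    also have "\<dots> = (1 - t) * (\<integral>q. w q * pickands_extreme q x \<partial>\<nu>)
        + t * (\<integral>q. w q * pickands_extreme q y \<partial>\<nu>)"
      using int xy by simp
    finally show "(\<integral>q. w q * pickands_extreme q ?z \<partial>\<nu>) \<le> \<dots>" .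
  qed auto
  fix x :: real assume x: "x \<in> {0..1}"
  have "max x (1 - x) = (\<integral>q. w q * max x (1 - x) \<partial>\<nu>)" using one by simp
  also have "\<dots> \<le> (\<integral>q. w q * pickands_extreme q x \<partial>\<nu>)"
    using intw int[OF x] w(1) pickands_extreme_bounds(1)[OF _ x]
    by (intro integral_mono) (auto intro: mult_left_mono simp del: max.bounded_iff)
  finally have lower: "max x (1 - x) \<le> (\<integral>q. w q * pickands_extreme q x \<partial>\<nu>)" .
  have "(\<integral>q. w q * pickands_extreme q x \<partial>\<nu>) \<le> (\<integral>q. w q \<partial>\<nu>)"
    using intw int[OF x] w(1) pickands_extreme_bounds(2)[OF _ x]
    by (intro integral_mono) (auto intro: mult_left_le)
  moreover have "(\<integral>q. w q * pickands_extreme q x \<partial>\<nu>) = (\<integral>q. w q * pickands_extreme q (1 - x) \<partial>\<nu>)"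
    by (rule Bochner_Integration.integral_cong) (use pickands_extreme_bounds(3)[OF _ x] in auto)
  ultimately show "max x (1 - x) \<le> (\<integral>q. w q * pickands_extreme q x \<partial>\<nu>) \<and>
      (\<integral>q. w q * pickands_extreme q x \<partial>\<nu>) \<le> 1 \<and>
      (\<integral>q. w q * pickands_extreme q x \<partial>\<nu>) = (\<integral>q. w q * pickands_extreme q (1 - x) \<partial>\<nu>)"
    using lower one by simp
qed

end

definition represents :: "real measure \<Rightarrow> (real \<Rightarrow> real) \<Rightarrow> bool" where
  "represents \<nu> A \<longleftrightarrow> prob_space \<nu> \<and> sets \<nu> = sets (restrict_space borel {0..1/2}) \<and>
     (\<forall>x\<in>{0..1}. has_bochner_integral \<nu> (\<lambda>q. pickands_extreme q x) (A x))"

lemma represents_iff: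
  "represents \<nu> A \<longleftrightarrow> prob_on_half \<nu> \<and>
     (\<forall>x\<in>{0..1}. has_bochner_integral \<nu> (\<lambda>q. pickands_extreme q x) (A x))"
  by (auto simp: represents_def prob_on_half_def prob_on_half_axioms_def)

lemma represents_truncated_mean:
  assumes "represents \<nu> A" "x \<in> {0..1/2}"
  shows "has_bochner_integral (distr \<nu> borel (\<lambda>q. q)) (\<lambda>q. min q x) (1 - A x)"
proof -
  interpret prob_on_half \<nu> using assms by (simp add: represents_iff)
  have "has_bochner_integral \<nu> (\<lambda>q. 1 - pickands_extreme q x) (1 - A x)"
  proof (rule has_bochner_integral_diff)
    show "has_bochner_integral \<nu> (\<lambda>_. 1) (1::real)"
      using has_bochner_integral_integrable[of \<nu> "\<lambda>_. 1::real"] by (simp add: prob_space)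
  qed (use assms in \<open>auto simp: represents_def\<close>)
  also have "?this \<longleftrightarrow> has_bochner_integral \<nu> (\<lambda>q. min q x) (1 - A x)"
    by (rule has_bochner_integral_cong) (use assms(2) in \<open>auto simp: space_eq pickands_extreme_eq\<close>)
  finally show ?thesis by (intro has_bochner_integral_distr) auto
qed

lemma represents_unique:
  assumes \<mu>: "represents \<mu> A" and \<nu>: "represents \<nu> A"
  shows "\<mu> = \<nu>"
proof -
  interpret \<mu>: prob_on_half \<mu> using \<mu> by (simp add: represents_iff)
  interpret \<nu>: prob_on_half \<nu> using \<nu> by (simp add: represents_iff)
  let ?M = "distr \<mu> borel (\<lambda>q. q)" and ?N = "distr \<nu> borel (\<lambda>q. q)"
  have outside: "cdf (distr \<rho> borel (\<lambda>q. q)) t = (if t < 0 then 0 else 1)"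
    if "prob_on_half \<rho>" "\<not> (0 \<le> t \<and> t < 1/2)" for \<rho> t
  proof -
    interpret prob_on_half \<rho> by fact
    have "cdf (distr \<rho> borel (\<lambda>q. q)) t = prob ({..t} \<inter> {0..1/2})"
      unfolding cdf_def by (subst measure_distr) (auto simp: space_eq)
    also have "{..t} \<inter> {0..1/2} = (if t < 0 then {} else space \<rho>)"
      using that(2) by (auto simp: space_eq)
    finally show ?thesis by (simp add: prob_space)
  qed
  have "cdf ?M t = cdf ?N t" for t
  proof (cases "0 \<le> t \<and> t < 1/2")
    case True
    note means = represents_truncated_mean[OF \<mu>] represents_truncated_mean[OF \<nu>]
    note dist = \<mu>.real_distribution_borel \<nu>.real_distribution_borel
    show ?thesis
      using True
      by (intro antisym cdf_le_of_truncated_means_eq[where a = 0 and b = "1/2" and g = "\<lambda>x. 1 - A x"]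
          dist means) auto
  next
    case False
    then show ?thesis
      using outside \<mu>.prob_on_half_axioms \<nu>.prob_on_half_axioms by auto
  qed
  then have "?M = ?N"
    by (intro cdf_unique \<mu>.real_distribution_borel \<nu>.real_distribution_borel) auto
  then show ?thesis
    using \<mu>.restrict_distr_borel \<nu>.restrict_distr_borel by metis
qed

lemma ex_represents:
  assumes "A \<in> exchangeable_pickands"
  shows "\<exists>\<nu>. represents \<nu> A"
proof -
  interpret exchangeable_pickands_function A by standard fact
  obtain M where M: "real_distribution M" "measure M {0..1/2} = 1"
    and int: "\<And>x. x \<in> {0..1/2} \<Longrightarrow> has_bochner_integral M (\<lambda>q. min q x) (1 - A x)"
    using ex_truncated_mean_representation by blast
  interpret M: real_distribution M by fact
  define \<nu> where "\<nu> = restrict_space M {0..1/2}"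
  have "prob_space \<nu>"
    unfolding \<nu>_def using M(2) by (intro prob_space_restrict_space) (auto simp: M.emeasure_eq_measure)
  then interpret prob_on_half \<nu>
    by (simp add: prob_on_half_def prob_on_half_axioms_def \<nu>_def sets_restrict_space)
  have AE: "AE q in M. q \<in> {0..1/2}"
    using M(2) by (subst M.AE_in_set_eq_1) auto
  have half: "has_bochner_integral \<nu> (\<lambda>q. pickands_extreme q x) (A x)" if x: "x \<in> {0..1/2}" for x
  proof -
    have one: "has_bochner_integral M (\<lambda>_. 1) (1::real)"
      using has_bochner_integral_integrable[of M "\<lambda>_. 1::real"] M.prob_space by simp
    have eq: "has_bochner_integral M (\<lambda>q. 1 - min q x) (A x)"
      using has_bochner_integral_diff[OF one int[OF x]] by simp
    have "AE q in M. 1 - min q x = indicator {0..1/2} q *\<^sub>R (1 - min q x)"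
      using AE by eventually_elim simp
    with eq have "has_bochner_integral M (\<lambda>q. indicator {0..1/2} q *\<^sub>R (1 - min q x)) (A x)"
      by (subst has_bochner_integral_cong_AE[symmetric]) auto
    then have "has_bochner_integral \<nu> (\<lambda>q. 1 - min q x) (A x)"
      by (simp add: \<nu>_def has_bochner_integral_iff integrable_restrict_space integral_restrict_space)
    also have "?this \<longleftrightarrow> ?thesis"
      by (rule has_bochner_integral_cong) (use x in \<open>auto simp: space_eq pickands_extreme_eq\<close>)
    finally show ?thesis .
  qed
  have "has_bochner_integral \<nu> (\<lambda>q. pickands_extreme q x) (A x)" if x: "x \<in> {0..1}" for x
  proof (cases "x \<le> 1/2")
    case False
    then have "has_bochner_integral \<nu> (\<lambda>q. pickands_extreme q (1 - x)) (A (1 - x))"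
      using x by (intro half) auto
    also have "?this \<longleftrightarrow> ?thesis"
      by (rule has_bochner_integral_cong) (use x pickands_extreme_bounds(3) sym in auto)
    finally show ?thesis .
  qed (use half x in auto)
  then show ?thesis using prob_on_half_axioms by (auto simp: represents_iff)
qed

section \<open>Extreme points\<close>

lemma exchangeable_pickands_eqI:
  assumes f: "f \<in> exchangeable_pickands" and g: "g \<in> exchangeable_pickands"
    and eq: "\<And>x. 0 \<le> x \<Longrightarrow> x \<le> 1/2 \<Longrightarrow> f x = g x"
  shows "f = g"
proof (rule extensionalityI[of _ "{0..1}"])
  interpret f: exchangeable_pickands_function f by standard fact
  interpret g: exchangeable_pickands_function g by standard fact
  fix x :: real assume "x \<in> {0..1}"
  then show "f x = g x"
    using eq[of x] eq[of "1 - x"] f.sym[of x] g.sym[of x] by (cases "x \<le> 1/2") auto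
qed (use f g exchangeable_pickandsD in auto)

lemma extreme_pickands_extreme:
  assumes a: "0 \<le> a" "a \<le> 1/2"
  shows "pickands_extreme a \<in> extreme_functions {0..1} exchangeable_pickands"
  unfolding extreme_functions_def
proof (intro CollectI conjI ballI impI)
  fix f g and t :: real
  assume f: "f \<in> exchangeable_pickands" and g: "g \<in> exchangeable_pickands"
    and t: "t \<in> {0<..<1}" and eq: "pickands_extreme a = mix {0..1} t f g"
  interpret f: exchangeable_pickands_function f by standard fact
  interpret g: exchangeable_pickands_function g by standard fact
  have val: "(1 - t) * f x + t * g x = 1 - min a x" if "0 \<le> x" "x \<le> 1/2" for x
    using fun_cong[OF eq, of x] that a by (simp add: mix_def pickands_extreme_eq)
  have extr: "u = c \<and> v = c"
    if "(1 - t) * u + t * v = c" "c \<le> u \<and> c \<le> v \<or> u \<le> c \<and> v \<le> c" for u v c :: real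
  proof -
    have "(1 - t) * (u - c) + t * (v - c) = 0" using that(1) by (simp add: algebra_simps)
    moreover have "0 \<le> (1 - t) * (u - c) \<and> 0 \<le> t * (v - c) \<or>
        (1 - t) * (u - c) \<le> 0 \<and> t * (v - c) \<le> 0"
      using that(2) t by (auto intro: mult_nonneg_nonneg mult_nonneg_nonpos)
    ultimately have "(1 - t) * (u - c) = 0" "t * (v - c) = 0" by linarith+
    then show ?thesis using t by simp
  qed
  have low: "f x = 1 - x \<and> g x = 1 - x" if "0 \<le> x" "x \<le> a" for x
    using val[of x] that a f.bounds g.bounds by (intro extr) auto
  have high: "f x = 1 - a \<and> g x = 1 - a" if "a \<le> x" "x \<le> 1/2" for x
    using val[of x] that a f.antimono[of a x] g.antimono[of a x] low[of a] by (intro extr) auto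
  show "f = g"
    using low high by (intro exchangeable_pickands_eqI f g) (metis linear)
qed (rule pickands_extreme_in[OF a])

text \<open>With \<open>m\<close> the mean of the representing measure, \<open>A\<close> is the midpoint of the mixtures with
  densities \<open>1 \<plusminus> (q - m)\<close>; if \<open>A\<close> is extreme, their agreement at \<open>1/2\<close> makes the variance vanish.\<close>

lemma extreme_imp_pickands_extreme:
  assumes ext: "A \<in> extreme_functions {0..1} exchangeable_pickands"
  shows "\<exists>a. 0 \<le> a \<and> a \<le> 1/2 \<and> A = pickands_extreme a"
proof -
  have A: "A \<in> exchangeable_pickands" using ext by (simp add: extreme_functions_def)
  then obtain \<nu> where \<nu>: "represents \<nu> A" using ex_represents by blast
  interpret prob_on_half \<nu> using \<nu> by (simp add: represents_iff)
  have AI: "A x = (\<integral>q. pickands_extreme q x \<partial>\<nu>)" "integrable \<nu> (\<lambda>q. pickands_extreme q x)"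
    if "x \<in> {0..1}" for x
    using \<nu> that by (auto simp: represents_def has_bochner_integral_iff)
  define m where "m = (\<integral>q. q \<partial>\<nu>)"
  have bnd: "integrable \<nu> f" if "f \<in> borel_measurable borel" "\<And>q. q \<in> {0..1/2} \<Longrightarrow> \<bar>f q\<bar> \<le> 1" for f :: "real \<Rightarrow> real"
    using that space_eq
    by (intro integrable_const_bound[where B = 1] AE_I2 measurable_of_borel) auto
  have idI: "integrable \<nu> (\<lambda>q. q)" by (rule bnd) auto
  have "0 \<le> m" unfolding m_def by (rule integral_nonneg_AE) (auto simp: space_eq)
  moreover have "m \<le> 1/2"
    unfolding m_def by (rule integral_le_const[OF idI]) (auto simp: space_eq)
  ultimately have m: "0 \<le> m" "m \<le> 1/2" .
  define w :: "real \<Rightarrow> real \<Rightarrow> real" where "w s q = 1 + s * (q - m)" for s q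
  define B where "B s = (\<lambda>x\<in>{0..1}. \<integral>q. w s q * pickands_extreme q x \<partial>\<nu>)" for s
  have wm: "w s \<in> borel_measurable \<nu>" for s
    unfolding w_def by (rule measurable_of_borel) measurable
  have wb: "0 \<le> w s q" "w s q \<le> 2" if "s \<in> {1, -1}" "q \<in> space \<nu>" for s q
    using that m by (auto simp: w_def space_eq)
  have wint: "integrable \<nu> (\<lambda>q. w s q * pickands_extreme q x)" if "s \<in> {1, -1}" "x \<in> {0..1}" for s x
    using wb that by (intro integrable_weighted[where C = 2] wm) (auto simp: abs_le_iff intro: order_trans)
  have B: "B s \<in> exchangeable_pickands" if "s \<in> {1, -1}" for s
    unfolding B_def
  proof (rule weighted_mixture_in[OF wm, where C = 2])
    show "(\<integral>q. w s q \<partial>\<nu>) = 1"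
      using idI by (simp add: w_def m_def[symmetric] prob_space)
  qed (use wb that in auto)
  have mid: "A = mix {0..1} (1/2) (B 1) (B (-1))"
  proof (rule extensionalityI[of _ "{0..1}"])
    fix x :: real assume x: "x \<in> {0..1}"
    have "(\<integral>q. w 1 q * pickands_extreme q x \<partial>\<nu>) + (\<integral>q. w (-1) q * pickands_extreme q x \<partial>\<nu>)
        = (\<integral>q. 2 * pickands_extreme q x \<partial>\<nu>)"
      using x by (subst Bochner_Integration.integral_add[OF wint wint, symmetric])
        (auto intro!: Bochner_Integration.integral_cong simp: w_def algebra_simps)
    then show "A x = mix {0..1} (1/2) (B 1) (B (-1)) x"
      using x AI[OF x] by (simp add: mix_def B_def)
  qed (use exchangeable_pickandsD(1)[OF A] in \<open>auto simp: mix_def\<close>)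
  have unique: "f = g" if "f \<in> exchangeable_pickands" "g \<in> exchangeable_pickands"
    "t \<in> {0<..<1}" "A = mix {0..1} t f g" for f g t
    using ext that unfolding extreme_functions_def by blast
  have "B 1 = B (-1)"
    by (rule unique[OF B B _ mid]) auto
  then have "B 1 (1/2) = B (-1) (1/2)" by simp
  then have "(\<integral>q. w 1 q * pickands_extreme q (1/2) \<partial>\<nu>) - (\<integral>q. w (-1) q * pickands_extreme q (1/2) \<partial>\<nu>) = 0"
    by (simp add: B_def)
  also have "(\<integral>q. w 1 q * pickands_extreme q (1/2) \<partial>\<nu>) - (\<integral>q. w (-1) q * pickands_extreme q (1/2) \<partial>\<nu>)
      = (\<integral>q. 2 * ((1 - m) * (q - m) - (q - m)\<^sup>2) \<partial>\<nu>)"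
    by (subst Bochner_Integration.integral_diff[OF wint wint, symmetric])
      (auto intro!: Bochner_Integration.integral_cong
        simp: w_def space_eq pickands_extreme_half power2_eq_square algebra_simps)
  also have sq: "integrable \<nu> (\<lambda>q. (q - m)\<^sup>2)"
    using m by (intro bnd) (auto simp: abs_square_le_1)
  then have "(\<integral>q. 2 * ((1 - m) * (q - m) - (q - m)\<^sup>2) \<partial>\<nu>) = - 2 * (\<integral>q. (q - m)\<^sup>2 \<partial>\<nu>)"
    using idI by (simp add: m_def[symmetric] prob_space)
  finally have "(\<integral>q. (q - m)\<^sup>2 \<partial>\<nu>) = 0" by simp
  then have AE: "AE q in \<nu>. q = m"
    using integral_nonneg_eq_0_iff_AE[OF sq] by simp
  have "A = pickands_extreme m"
  proof (rule extensionalityI[of _ "{0..1}"])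
    fix x :: real assume x: "x \<in> {0..1}"
    have "(\<integral>q. pickands_extreme q x \<partial>\<nu>) = (\<integral>q. pickands_extreme m x \<partial>\<nu>)"
      by (rule integral_cong_AE) (use AE x in auto)
    then show "A x = pickands_extreme m x" using AI[OF x] by (simp add: prob_space)
  qed (use exchangeable_pickandsD(1)[OF A] in \<open>auto simp: pickands_extreme_def\<close>)
  then show ?thesis using m by blast
qed

lemma extreme_functions_exchangeable_pickands:
  "extreme_functions {0..1} exchangeable_pickands = pickands_extreme ` {0..1/2}"
  using extreme_pickands_extreme extreme_imp_pickands_extreme by fastforce

lemma choquet_simplex_exchangeable_pickands: "choquet_simplex {0..1} exchangeable_pickands"
  unfolding choquet_simplex_def extreme_functions_exchangeable_pickands
proof (intro conjI ballI convex_function_set_exchangeable_pickands)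
  fix A assume "A \<in> exchangeable_pickands"
  then obtain \<nu> where \<nu>: "represents \<nu> A" using ex_represents by blast
  interpret prob_on_half \<nu> using \<nu> by (simp add: represents_iff)
  define E where "E = pickands_extreme ` {0..1/2}"
  define I where "I = restrict_space (borel :: real measure) {0..1/2}"
  define B where "B = restrict_space (borel :: (real \<Rightarrow> real) measure) E"
  define param where "param e = 1 - e (1/2)" for e :: "real \<Rightarrow> real"
  have param: "param e \<in> {0..1/2}" "pickands_extreme (param e) = e" if "e \<in> E" for e
    using that by (auto simp: E_def param_def pickands_extreme_half)
  have eval: "(\<lambda>e. e x) \<in> borel_measurable B" for x
    unfolding B_def by (intro measurable_restrict_space1 borel_measurable_continuous_onI) simp
  have meas_param: "param \<in> measurable B I"
    unfolding I_def
  proof (rule measurable_restrict_space2)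
    show "param \<in> borel_measurable B" unfolding param_def using eval by measurable
  qed (use param in \<open>auto simp: B_def space_restrict_space\<close>)
  have "continuous_on {0..1/2} (\<lambda>a. pickands_extreme a x)" for x
    unfolding pickands_extreme_def by (cases "x \<in> {0..1}") (auto intro!: continuous_intros)
  then have meas_pe: "pickands_extreme \<in> measurable I B"
    unfolding I_def B_def
    by (intro measurable_restrict_space2 borel_measurable_continuous_on_restrict
        continuous_on_coordinatewise_then_product) (auto simp: E_def space_restrict_space)
  show "\<exists>!\<mu>. prob_space \<mu> \<and> sets \<mu> = sets (restrict_space borel (pickands_extreme ` {0..1/2})) \<and>
      (\<forall>x\<in>{0..1}. has_bochner_integral \<mu> (\<lambda>e. e x) (A x))"
    unfolding E_def[symmetric] B_def[symmetric]
  proof (rule ex1I[of _ "distr \<nu> B pickands_extreme"], intro conjI ballI)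
    have pe: "pickands_extreme \<in> measurable \<nu> B"
      using meas_pe sets_eq by (simp add: I_def cong: measurable_cong_sets)
    show "prob_space (distr \<nu> B pickands_extreme)" using pe by (rule prob_space_distr)
    show "has_bochner_integral (distr \<nu> B pickands_extreme) (\<lambda>e. e x) (A x)" if "x \<in> {0..1}" for x
      using \<nu> that by (intro has_bochner_integral_distr eval pe) (auto simp: represents_def)
  next
    fix \<mu> assume *: "prob_space \<mu> \<and> sets \<mu> = sets B \<and>
      (\<forall>x\<in>{0..1}. has_bochner_integral \<mu> (\<lambda>e. e x) (A x))"
    then interpret \<mu>: prob_space \<mu> by simp
    have sets: "sets \<mu> = sets B" and sp: "space \<mu> = E"
      using * sets_eq_imp_space_eq[of \<mu> B] by (auto simp: B_def space_restrict_space)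
    have meas: "param \<in> measurable \<mu> I"
      using meas_param sets by (simp cong: measurable_cong_sets)
    have "represents (distr \<mu> I param) A"
      unfolding represents_def
    proof (intro conjI ballI)
      show "prob_space (distr \<mu> I param)" using meas by (rule \<mu>.prob_space_distr)
      show "sets (distr \<mu> I param) = sets (restrict_space borel {0..1/2})" by (simp add: I_def)
      fix x :: real assume x: "x \<in> {0..1}"
      have "has_bochner_integral \<mu> (\<lambda>e. e x) (A x)" using * x by simp
      also have "?this \<longleftrightarrow> has_bochner_integral \<mu> (\<lambda>e. pickands_extreme (param e) x) (A x)"
        by (rule has_bochner_integral_cong) (auto simp: sp param)
      finally show "has_bochner_integral (distr \<mu> I param) (\<lambda>q. pickands_extreme q x) (A x)"
        using measurable_pickands_extreme[OF x] sets_eq meas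
        by (intro has_bochner_integral_distr) (auto simp: I_def cong: measurable_cong_sets)
    qed
    then have "distr \<nu> B pickands_extreme = distr (distr \<mu> I param) B pickands_extreme"
      using represents_unique[OF \<nu>] by simp
    also have "\<dots> = distr \<mu> B (\<lambda>e. e)"
      unfolding distr_distr[OF meas_pe meas]
      by (rule distr_cong) (auto simp: sp param)
    also have "\<dots> = \<mu>" using sets by (intro distr_id2) simp
    finally show "\<mu> = distr \<nu> B pickands_extreme" by simp
  qed simp
qed

theorem lemma2p3:
  shows "choquet_simplex {0..1} exchangeable_pickands \<and>
    extreme_functions {0..1} exchangeable_pickands = {pickands_extreme a | a. 0 \<le> a \<and> a \<le> 1/2} \<and>
    (\<forall>A\<in>exchangeable_pickands. \<exists>!\<nu>. prob_space \<nu> \<and>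
       sets \<nu> = sets (restrict_space borel {0..1/2}) \<and>
       (\<forall>x\<in>{0..1}. has_bochner_integral \<nu> (\<lambda>q. pickands_extreme q x) (A x)))"
proof (intro conjI ballI)
  show "extreme_functions {0..1} exchangeable_pickands = {pickands_extreme a | a. 0 \<le> a \<and> a \<le> 1/2}"
    unfolding extreme_functions_exchangeable_pickands by auto
  show "\<exists>!\<nu>. prob_space \<nu> \<and> sets \<nu> = sets (restrict_space borel {0..1/2}) \<and>
      (\<forall>x\<in>{0..1}. has_bochner_integral \<nu> (\<lambda>q. pickands_extreme q x) (A x))"
    if "A \<in> exchangeable_pickands" for A
    using ex_represents[OF that] represents_unique unfolding represents_def[symmetric] by blast
qed (rule choquet_simplex_exchangeable_pickands)

end
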